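(* Let $n\ge2$, $s\in(0,1)$, and let $p\in\left(1,\frac{n+2}{n-2}\right)$ if $n>2$, $p\in(1,+\infty)$ if $n=2$. Let $u$ be a positive classical solution of $$-\Delta u+(-\Delta)^su+u=u^p\ \text{ in }\mathbb{R}^n,\qquad \lim_{|x|\to+\infty}u(x)=0.$$ Then there exist constants $0<C_1\le C_2$ such that, for every $|x|\ge1$, $$\frac{C_1}{|x|^{n+2s}}\le u(x)\le\frac{C_2}{|x|^{n+2s}}.$$
   Context: The fractional Laplacian is $(-\Delta)^su(x)=c_{n,s}\,\mathrm{P.V.}\int_{\mathbb{R}^n}\frac{u(x)-u(y)}{|x-y|^{n+2s}}\,dy$, where $c_{n,s}>0$ is a normalization constant (its explicit value plays no role). A positive classical solution is a function $u\in C^2(\mathbb{R}^n)$ with $u>0$ in $\mathbb{R}^n$ satisfying the equation pointwise. *)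

theory Defs
  imports "HOL-Analysis.Analysis"
begin

definition partial_deriv :: "'n \<Rightarrow> (real^'n \<Rightarrow> real) \<Rightarrow> real^'n \<Rightarrow> real" where
  "partial_deriv i f x = deriv (\<lambda>t. f (x + t *\<^sub>R axis i 1)) 0"

text \<open>Differentiability is required explicitly because \<^const>\<open>deriv\<close> is total; together with the
  continuity of the partial derivatives this is the usual class of \<open>k\<close> times continuously
  differentiable functions.\<close>

primrec C_k :: "nat \<Rightarrow> (real^'n \<Rightarrow> real) \<Rightarrow> bool" where
  "C_k 0 f \<longleftrightarrow> continuous_on UNIV f"
| "C_k (Suc k) f \<longleftrightarrow> f differentiable_on UNIV \<and> (\<forall>i. C_k k (partial_deriv i f))"

definition laplacian :: "(real^'n \<Rightarrow> real) \<Rightarrow> real^'n \<Rightarrow> real" where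
  "laplacian f x = (\<Sum>i\<in>UNIV. partial_deriv i (partial_deriv i f) x)"

text \<open>\<open>has_fractional_laplacian c s u x L\<close>: the principal value defining the fractional Laplacian
  of order \<open>s\<close> of \<open>u\<close> at \<open>x\<close> exists, and with normalization constant \<open>c\<close> it yields the
  value \<open>L\<close>.\<close>

definition has_fractional_laplacian ::
    "real \<Rightarrow> real \<Rightarrow> (real^'n \<Rightarrow> real) \<Rightarrow> real^'n \<Rightarrow> real \<Rightarrow> bool" where
  "has_fractional_laplacian c s u x L \<longleftrightarrow>
     (\<forall>\<epsilon>>0. set_integrable lborel (- ball x \<epsilon>)
        (\<lambda>y. (u x - u y) / norm (x - y) powr (real CARD('n) + 2 * s))) \<and>
     ((\<lambda>\<epsilon>. c * (LINT y:(- ball x \<epsilon>)|lborel.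
        (u x - u y) / norm (x - y) powr (real CARD('n) + 2 * s))) \<longlongrightarrow> L) (at_right 0)"

definition positive_classical_solution ::
    "real \<Rightarrow> real \<Rightarrow> real \<Rightarrow> (real^'n \<Rightarrow> real) \<Rightarrow> bool" where
  "positive_classical_solution c s p u \<longleftrightarrow>
     C_k 2 u \<and> (\<forall>x. u x > 0) \<and>
     (\<forall>x. \<exists>L. has_fractional_laplacian c s u x L \<and>
        - laplacian u x + L + u x = u x powr p)"

end

theory Submission
  imports Defs
begin

text \<open>Both bounds follow by comparison with multiples of dilates of the explicit function
  \<open>w x = (1 + |x|\<^sup>2) powr (- (n + 2 s) / 2)\<close>. If \<open>u \<le> A w (\<delta> x)\<close>
  (respectively \<open>\<eta> w x \<le> u\<close>) fails, the difference attains a negative global minimum at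
  some \<open>x0\<close>, where the barrier touches \<open>u\<close> up to a constant; this bounds both the Laplacian and the
  fractional Laplacian of \<open>u\<close> at \<open>x0\<close> on one side.

  Upper bound: the operators applied to \<open>w (\<delta> x)\<close> cost only a small multiple of
  \<open>w (\<delta> x)\<close> when \<open>\<delta>\<close> is small, whereas \<open>u powr p \<le> u / 2\<close> far out leaves a zeroth order term
  \<open>u / 2\<close>; \<open>A\<close> is chosen so large that the touching point lies far out.
  Lower bound: the mass of \<open>u\<close> in the unit ball contributes a term of
  order \<open>- |x0| powr (- (n + 2 s))\<close> to the fractional Laplacian at \<open>x0\<close>, which beats the cost
  \<open>O(\<eta> |x0| powr (- (n + 2 s)))\<close> of the barrier for small \<open>\<eta>\<close>.\<close>

lemma powr_dyadic_le:
  fixes x y \<beta> :: real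
  assumes "0 < y" "y / 2 \<le> x" "x \<le> 2 * y"
  shows "x powr \<beta> \<le> 2 powr \<bar>\<beta>\<bar> * y powr \<beta>"
proof (cases "\<beta> \<ge> 0")
  case True
  have "x powr \<beta> \<le> (2 * y) powr \<beta>"
    using assms True by (intro powr_mono2) auto
  then show ?thesis using assms True by (simp add: powr_mult)
next
  case False
  have "x powr \<beta> \<le> (y / 2) powr \<beta>"
    using assms False by (intro powr_mono2') auto
  also have "\<dots> = 2 powr (- \<beta>) * y powr \<beta>"
    using assms by (simp add: powr_divide powr_minus divide_simps)
  finally show ?thesis using False by simp
qed

lemma set_integrable_norm_powr_dyadic:
  fixes S :: "'a::euclidean_space set"
  assumes r: "0 < r" and \<theta>: "0 < \<theta>" and lt1: "\<theta> powr (\<beta> + real DIM('a)) < 1"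
    and S: "S \<in> sets borel"
    and cover: "\<And>z. z \<in> S \<Longrightarrow> z \<noteq> 0 \<Longrightarrow> \<exists>k::nat. r * \<theta> ^ k / 2 \<le> norm z \<and> norm z \<le> 2 * (r * \<theta> ^ k)"
  shows "set_integrable lborel S (\<lambda>z. norm z powr \<beta>)"
proof -
  define q where "q = \<theta> powr (\<beta> + real DIM('a))"
  define T where "T k = cball (0::'a) (2 * (r * \<theta> ^ k))" for k :: nat
  define g where "g k = 2 powr \<bar>\<beta>\<bar> * (r * \<theta> ^ k) powr \<beta>" for k :: nat
  define V where "V = unit_ball_vol (real DIM('a))"
  have V: "V \<ge> 0" by (simp add: V_def)
  have pos: "0 < r * \<theta> ^ k" for k :: nat using r \<theta> by simp
  have geo: "g k * (V * (2 * (r * \<theta> ^ k)) ^ DIM('a))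
      = (2 powr \<bar>\<beta>\<bar> * r powr \<beta> * V * (2 * r) ^ DIM('a)) * q ^ k" for k
  proof -
    have "(\<theta> ^ k) powr \<beta> * (\<theta> ^ k) ^ DIM('a) = (\<theta> ^ k) powr \<beta> * (\<theta> ^ k) powr real DIM('a)"
      using \<theta> by (subst powr_realpow) auto
    also have "\<dots> = (\<theta> ^ k) powr (\<beta> + real DIM('a))" by (simp add: powr_add)
    also have "\<dots> = (\<theta> powr real k) powr (\<beta> + real DIM('a))"
      using \<theta> by (simp only: powr_realpow)
    also have "\<dots> = q powr real k"
      by (simp only: q_def powr_powr mult.commute)
    also have "\<dots> = q ^ k"
      using \<theta> by (intro powr_realpow) (simp add: q_def)
    finally have "(\<theta> ^ k) powr \<beta> * (\<theta> ^ k) ^ DIM('a) = q ^ k" .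
    then show ?thesis
      using r \<theta> unfolding g_def by (simp add: powr_mult power_mult_distrib algebra_simps)
  qed
  have "(\<integral>\<^sup>+z. ennreal (indicator S z * norm z powr \<beta>) \<partial>lborel)
      \<le> (\<integral>\<^sup>+z. (\<Sum>k. ennreal (g k) * indicator (T k) z) \<partial>lborel)"
  proof (intro nn_integral_mono)
    fix z :: 'a
    show "ennreal (indicator S z * norm z powr \<beta>) \<le> (\<Sum>k. ennreal (g k) * indicator (T k) z)"
    proof (cases "z \<in> S \<and> z \<noteq> 0")
      case True
      then obtain k where k: "r * \<theta> ^ k / 2 \<le> norm z" "norm z \<le> 2 * (r * \<theta> ^ k)"
        using cover by blast
      have "ennreal (indicator S z * norm z powr \<beta>) \<le> ennreal (g k) * indicator (T k) z"
        using True k powr_dyadic_le[OF pos k(1) k(2), of \<beta>]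
        by (simp add: g_def T_def)
      also have "\<dots> \<le> (\<Sum>k. ennreal (g k) * indicator (T k) z)"
        using sum_le_suminf[of "\<lambda>k. ennreal (g k) * indicator (T k) z" "{k}"]
        by (simp del: sum_mult_indicator)
      finally show ?thesis .
    qed (auto simp: indicator_def)
  qed
  also have "\<dots> = (\<Sum>k. ennreal (g k) * emeasure lborel (T k))"
  proof -
    have T: "T k \<in> sets lborel" for k by (simp add: T_def)
    have "(\<lambda>z. ennreal (g k) * indicator (T k) z) \<in> borel_measurable lborel" for k
      using T by (intro borel_measurable_times_ennreal borel_measurable_indicator) auto
    then show ?thesis
      using T by (simp add: nn_integral_suminf nn_integral_cmult_indicator del: sets_lborel)
  qed
  also have "\<dots> = (\<Sum>k. ennreal ((2 powr \<bar>\<beta>\<bar> * r powr \<beta> * V * (2 * r) ^ DIM('a)) * q ^ k))"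
  proof (intro arg_cong[where f=suminf] ext)
    fix k
    have "emeasure lborel (T k) = ennreal (V * (2 * (r * \<theta> ^ k)) ^ DIM('a))"
      unfolding T_def V_def using pos[of k] by (subst emeasure_cball) auto
    then show "ennreal (g k) * emeasure lborel (T k) =
        ennreal ((2 powr \<bar>\<beta>\<bar> * r powr \<beta> * V * (2 * r) ^ DIM('a)) * q ^ k)"
      using V pos[of k] by (simp only: geo[symmetric]) (auto simp: g_def ennreal_mult')
  qed
  also have "\<dots> < \<infinity>"
  proof -
    have "summable (\<lambda>k. (2 powr \<bar>\<beta>\<bar> * r powr \<beta> * V * (2 * r) ^ DIM('a)) * q ^ k)"
      using lt1 by (intro summable_mult summable_geometric) (simp add: q_def)
    then show ?thesis using V r by (subst suminf_ennreal2) (auto simp: q_def)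
  qed
  finally have fin: "(\<integral>\<^sup>+z. ennreal (indicator S z * norm z powr \<beta>) \<partial>lborel) < \<infinity>" .
  have "(\<integral>\<^sup>+z. ennreal (norm (indicator S z * norm z powr \<beta>)) \<partial>lborel)
      = (\<integral>\<^sup>+z. ennreal (indicator S z * norm z powr \<beta>) \<partial>lborel)"
    by (intro nn_integral_cong) (auto simp: indicator_def)
  with fin S show ?thesis
    unfolding set_integrable_def by (intro integrableI_bounded) auto
qed

lemma set_integrable_norm_powr_ball:
  fixes r :: real
  assumes "\<beta> > - real DIM('a)" "0 < r"
  shows "set_integrable lborel (ball (0::'a::euclidean_space) r) (\<lambda>z. norm z powr \<beta>)"
proof (rule set_integrable_norm_powr_dyadic[where \<theta>="1/2" and r=r])
  show "(1/2) powr (\<beta> + real DIM('a)) < 1"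
    using assms(1) powr_less_mono2[of "\<beta> + real DIM('a)" "1/2" 1] by simp
  fix z :: 'a assume z: "z \<in> ball 0 r" "z \<noteq> 0"
  define P where "P k \<longleftrightarrow> r * (1/2) ^ k \<le> norm z" for k :: nat
  obtain j where "(1/2) ^ j < norm z / r"
    using real_arch_pow_inv[of "norm z / r" "1/2"] z assms by auto
  then have "P j" using assms by (auto simp: P_def field_simps)
  then have L: "P (LEAST k. P k)" by (rule LeastI)
  have "\<not> P 0" using z by (simp add: P_def)
  then obtain k where k: "(LEAST k. P k) = Suc k" using L by (metis not0_implies_Suc)
  then have "\<not> P k" by (metis not_less_Least lessI)
  then show "\<exists>k. r * (1/2) ^ k / 2 \<le> norm z \<and> norm z \<le> 2 * (r * (1/2) ^ k)"
    using L k z by (intro exI[of _ k]) (auto simp: P_def)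
qed (use assms in auto)

lemma set_integrable_norm_powr_outside_ball:
  fixes r :: real
  assumes "\<beta> < - real DIM('a)" "0 < r"
  shows "set_integrable lborel (- ball (0::'a::euclidean_space) r) (\<lambda>z. norm z powr \<beta>)"
proof (rule set_integrable_norm_powr_dyadic[where \<theta>=2 and r=r])
  show "2 powr (\<beta> + real DIM('a)) < 1"
    using assms(1) powr_less_mono[of "\<beta> + real DIM('a)" 0 2] by simp
  fix z :: 'a assume z: "z \<in> - ball 0 r" "z \<noteq> 0"
  define P where "P k \<longleftrightarrow> norm z < r * 2 ^ k" for k :: nat
  obtain j where "norm z / r < 2 ^ j"
    using real_arch_pow[of 2 "norm z / r"] by auto
  then have "P j" using assms by (auto simp: P_def field_simps)
  then have L: "P (LEAST k. P k)" by (rule LeastI)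
  have "\<not> P 0" using z by (simp add: P_def)
  then obtain k where k: "(LEAST k. P k) = Suc k" using L by (metis not0_implies_Suc)
  then have "\<not> P k" by (metis not_less_Least lessI)
  then show "\<exists>k. r * 2 ^ k / 2 \<le> norm z \<and> norm z \<le> 2 * (r * 2 ^ k)"
    using L k z assms by (intro exI[of _ k]) (auto simp: P_def)
qed (use assms in auto)

lemma tendsto_set_integral_outside_ball:
  fixes f :: "'a::euclidean_space \<Rightarrow> real"
  assumes "set_integrable lborel (- ball 0 1) f"
  shows "(\<lambda>k. LINT z:(- ball 0 (real (Suc k)))|lborel. f z) \<longlonglongrightarrow> 0"
proof -
  have emp: "(\<Inter>k. - ball (0::'a) (real (Suc k))) = {}"
  proof -
    have "\<exists>k. norm z < real (Suc k)" for z :: 'a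
      using reals_Archimedean2[of "norm z"] by (metis less_Suc_eq of_nat_less_iff order_less_trans)
    then have "\<exists>k. norm z < 1 + real k" for z :: 'a by simp
    then show ?thesis by (force simp: not_less[symmetric])
  qed
  have "decseq (\<lambda>k. - ball (0::'a) (real (Suc k)))"
    by (auto simp: decseq_def)
  moreover have "set_integrable lborel (- ball (0::'a) (real (Suc 0))) f" using assms by simp
  ultimately have "(\<lambda>k. LINT z:(- ball 0 (real (Suc k)))|lborel. f z) \<longlonglongrightarrow>
      (LINT z:(\<Inter>k. - ball 0 (real (Suc k)))|lborel. f z)"
    by (intro set_integral_cont_down) auto
  then show ?thesis unfolding emp by (simp add: set_lebesgue_integral_def)
qed

lemma lborel_integral_translate:
  fixes f :: "'a::euclidean_space \<Rightarrow> real"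
  assumes "integrable lborel f"
  shows "integrable lborel (\<lambda>z. f (x + z))" "(LINT z|lborel. f (x + z)) = (LINT y|lborel. f y)"
proof -
  have D: "distr lborel borel ((+) x) = (lborel :: 'a measure)" by (rule lborel_distr_plus)
  show "integrable lborel (\<lambda>z. f (x + z))"
    using assms borel_measurable_integrable[OF assms]
    by (subst (asm) D[symmetric]) (subst (asm) integrable_distr_eq, auto)
  show "(LINT z|lborel. f (x + z)) = (LINT y|lborel. f y)"
    using assms by (subst D[symmetric]) (subst integral_distr, auto)
qed

lemma lborel_integral_reflect:
  fixes f :: "'a::euclidean_space \<Rightarrow> real"
  assumes "integrable lborel f"
  shows "(LINT z|lborel. f (- z)) = (LINT y|lborel. f y)"
proof -
  have D: "distr lborel borel uminus = (lborel :: 'a measure)"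
    by (subst lborel_affine[of "-1" 0]) (auto simp: density_1)
  show "(LINT z|lborel. f (- z)) = (LINT y|lborel. f y)"
    using assms by (subst D[symmetric]) (subst integral_distr, auto)
qed

lemma second_derivative_le:
  fixes h h' :: "real \<Rightarrow> real"
  assumes h: "\<And>t. (h has_real_derivative h' t) (at t)"
    and h': "(h' has_real_derivative h2) (at 0)"
    and \<rho>: "0 < \<rho>" and le: "\<And>t. \<bar>t\<bar> < \<rho> \<Longrightarrow> h t \<le> h 0 + b * t + M * t\<^sup>2"
  shows "h2 \<le> 2 * M"
proof (rule ccontr)
  assume contra: "\<not> h2 \<le> 2 * M"
  define k where "k t = h 0 + b * t + M * t\<^sup>2 - h t" for t
  define k' where "k' t = b + 2 * M * t - h' t" for t
  have k: "(k has_real_derivative k' t) (at t)" for t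
    unfolding k_def k'_def by (auto intro!: derivative_eq_intros h)
  have k'0: "k' 0 = 0"
  proof (rule DERIV_local_min[OF k \<rho>])
    show "\<forall>y. \<bar>0 - y\<bar> < \<rho> \<longrightarrow> k 0 \<le> k y"
      using le by (auto simp: k_def)
  qed
  have "(k' has_real_derivative 2 * M - h2) (at 0)"
    unfolding k'_def by (auto intro!: derivative_eq_intros h')
  from DERIV_neg_dec_right[OF this] contra obtain d where d: "d > 0"
    "\<And>t. 0 < t \<Longrightarrow> t < d \<Longrightarrow> k' t < 0"
    unfolding k'0 by force
  define t where "t = min d \<rho> / 2"
  have t: "0 < t" "t < d" "t < \<rho>" using d \<rho> by (auto simp: t_def)
  have "k t < k 0"
  proof (rule DERIV_neg_imp_decreasing_open[OF t(1)])
    show "\<exists>y. (k has_real_derivative y) (at x) \<and> y < 0" if "0 < x" "x < t" for x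
      using k d(2)[of x] that t by force
    show "continuous_on {0..t} k"
      using k by (meson DERIV_isCont continuous_at_imp_continuous_on)
  qed
  moreover have "k 0 \<le> k t" using le[of t] t by (simp add: k_def)
  ultimately show False by simp
qed

lemma has_partial_derivative:
  fixes f :: "real^'n \<Rightarrow> real"
  assumes "f differentiable_on UNIV"
  shows "((\<lambda>t. f (x + t *\<^sub>R axis i 1)) has_real_derivative partial_deriv i f (x + t *\<^sub>R axis i 1)) (at t)"
proof -
  have "(\<lambda>r. f ((x + t *\<^sub>R axis i 1) + r *\<^sub>R axis i 1)) differentiable (at 0)"
  proof -
    have "f differentiable (at ((x + t *\<^sub>R axis i 1) + 0 *\<^sub>R axis i 1))"
      using assms by (auto simp: differentiable_on_def)
    moreover have "(\<lambda>r. (x + t *\<^sub>R axis i 1) + r *\<^sub>R axis i 1) differentiable (at (0::real))"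
      by (auto intro!: derivative_intros)
    ultimately show ?thesis
      using differentiable_chain_at[of "\<lambda>r. (x + t *\<^sub>R axis i 1) + r *\<^sub>R axis i 1" 0 f]
      by (simp add: o_def)
  qed
  then have "((\<lambda>r. f ((x + t *\<^sub>R axis i 1) + r *\<^sub>R axis i 1)) has_real_derivative
      partial_deriv i f (x + t *\<^sub>R axis i 1)) (at 0)"
    unfolding partial_deriv_def
    by (simp add: DERIV_deriv_iff_real_differentiable)
  then have "((\<lambda>r. f (x + (r + t) *\<^sub>R axis i 1)) has_real_derivative
      partial_deriv i f (x + t *\<^sub>R axis i 1)) (at 0)"
    by (simp add: algebra_simps)
  then show ?thesis
    using DERIV_shift[of "\<lambda>r. f (x + r *\<^sub>R axis i 1)" "partial_deriv i f (x + t *\<^sub>R axis i 1)" 0 t]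
    by simp
qed

text \<open>With \<open>\<sigma> = 1\<close> this is used where a barrier touches \<open>u\<close> from above, with \<open>\<sigma> = - 1\<close> where it
  touches from below; likewise for the fractional Laplacian.\<close>

lemma laplacian_le:
  fixes u :: "real^'n \<Rightarrow> real"
  assumes u: "C_k 2 u" and \<rho>: "0 < \<rho>"
    and near: "\<And>z. norm z < \<rho> \<Longrightarrow> \<sigma> * (u (x + z) - u x) \<le> b \<bullet> z + M * (norm z)\<^sup>2"
  shows "\<sigma> * laplacian u x \<le> 2 * real CARD('n) * M"
proof -
  have "\<sigma> * partial_deriv i (partial_deriv i u) x \<le> 2 * M" for i
  proof (rule second_derivative_le[where h = "\<lambda>t. \<sigma> * u (x + t *\<^sub>R axis i 1)"
        and h' = "\<lambda>t. \<sigma> * partial_deriv i u (x + t *\<^sub>R axis i 1)" and b = "b $ i", OF _ _ \<rho>])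
    have d: "u differentiable_on UNIV" "partial_deriv i u differentiable_on UNIV"
      using u by (auto simp: numeral_2_eq_2)
    show "((\<lambda>t. \<sigma> * u (x + t *\<^sub>R axis i 1)) has_real_derivative
        \<sigma> * partial_deriv i u (x + t *\<^sub>R axis i 1)) (at t)" for t
      by (intro DERIV_cmult has_partial_derivative d)
    show "((\<lambda>t. \<sigma> * partial_deriv i u (x + t *\<^sub>R axis i 1)) has_real_derivative
        \<sigma> * partial_deriv i (partial_deriv i u) x) (at 0)"
      using DERIV_cmult[OF has_partial_derivative[OF d(2), of x i 0], of \<sigma>] by simp
    show "\<sigma> * u (x + t *\<^sub>R axis i 1) \<le> \<sigma> * u (x + 0 *\<^sub>R axis i 1) + b $ i * t + M * t\<^sup>2"
      if "\<bar>t\<bar> < \<rho>" for t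
      using near[of "t *\<^sub>R axis i 1"] that
      by (simp add: inner_axis algebra_simps)
  qed
  then have "(\<Sum>i\<in>UNIV. \<sigma> * partial_deriv i (partial_deriv i u) x) \<le> (\<Sum>i\<in>(UNIV::'n set). 2 * M)"
    by (intro sum_mono) auto
  then show ?thesis by (simp add: laplacian_def sum_distrib_left mult_ac)
qed

lemma fractional_laplacian_ge:
  fixes u :: "real^'n \<Rightarrow> real"
  defines "d \<equiv> \<lambda>s. real CARD('n) + 2 * s"
  assumes frac: "has_fractional_laplacian c s u x L"
    and s: "s < 1" and c: "0 \<le> c" and \<rho>: "0 < \<rho>" and M: "0 \<le> M"
    and near: "\<And>z. norm z < \<rho> \<Longrightarrow> \<sigma> * (u (x + z) - u x) \<le> b \<bullet> z + M * (norm z)\<^sup>2"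
    and far: "\<And>z. \<rho> \<le> norm z \<Longrightarrow> \<sigma> * (u (x + z) - u x) * norm z powr (- d s) \<le> h z"
    and h: "set_integrable lborel (- ball 0 \<rho>) h"
  shows "- \<sigma> * L \<le> c * (M * (LINT z:ball (0::real^'n) \<rho>|lborel. norm z powr (2 - d s))
      + (LINT z:(- ball 0 \<rho>)|lborel. h z))" (is "_ \<le> ?R")
proof -
  define F where "F \<epsilon> = (LINT y:(- ball x \<epsilon>)|lborel.
        (u x - u y) / norm (x - y) powr (real CARD('n) + 2 * s))" for \<epsilon>
  have lim: "((\<lambda>\<epsilon>. - \<sigma> * (c * F \<epsilon>)) \<longlongrightarrow> - \<sigma> * L) (at_right 0)"
    using frac unfolding has_fractional_laplacian_def F_def by (intro tendsto_mult_left) auto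
  have J: "set_integrable lborel (ball (0::real^'n) \<rho>) (\<lambda>z. norm z powr (2 - d s))"
    using \<rho> s by (intro set_integrable_norm_powr_ball) (auto simp: d_def)
  have bound: "- \<sigma> * (c * F \<epsilon>) \<le> ?R" if \<epsilon>: "0 < \<epsilon>" "\<epsilon> < \<rho>" for \<epsilon>
  proof -
    define f0 where "f0 y = indicator (- ball x \<epsilon>) y * ((u x - u y) / norm (x - y) powr d s)" for y
    have f0: "integrable lborel f0" "(LINT y|lborel. f0 y) = F \<epsilon>"
      using frac \<epsilon> unfolding has_fractional_laplacian_def f0_def[abs_def] d_def F_def set_integrable_def
        set_lebesgue_integral_def by auto
    define g where "g z = - \<sigma> * f0 (x + z)" for z
    have g: "integrable lborel g" "(LINT z|lborel. g z) = - \<sigma> * F \<epsilon>"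
      using lborel_integral_translate[OF f0(1), of x] f0(2) unfolding g_def[abs_def] by auto
    have g_eq: "g z = indicator (- ball 0 \<epsilon>) z * (\<sigma> * (u (x + z) - u x) * norm z powr (- d s))" for z
      by (simp add: g_def f0_def indicator_def dist_norm powr_minus divide_simps algebra_simps)
    define l where "l z = indicator (- ball 0 \<epsilon> \<inter> ball 0 \<rho>) z * ((b \<bullet> z) * norm z powr (- d s))" for z
    have l: "integrable lborel l"
    proof -
      define B where "B = norm b * \<rho> * (\<rho> powr (- d s) + \<epsilon> powr (- d s))"
      have "set_integrable lborel (ball (0::real^'n) \<rho>) (\<lambda>z. B)"
        unfolding set_integrable_def
        using emeasure_lborel_ball_finite[of "0::real^'n" \<rho>]
        by (intro integrable_scaleR_left integrable_real_indicator) auto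
      then have I: "integrable lborel (\<lambda>z. indicator (ball (0::real^'n) \<rho>) z * B)"
        by (simp add: set_integrable_def)
      have B0: "0 \<le> B" using \<rho> by (simp add: B_def)
      show ?thesis
      proof (rule Bochner_Integration.integrable_bound[OF I])
        show "l \<in> borel_measurable lborel" unfolding l_def[abs_def]
          by (intro borel_measurable_times borel_measurable_indicator powr_real_measurable
              borel_measurable_inner borel_measurable_norm) auto
        have "\<bar>l z\<bar> \<le> indicator (ball 0 \<rho>) z * B" for z
        proof (cases "z \<in> - ball 0 \<epsilon> \<inter> ball 0 \<rho>")
          case True
          then have z: "\<epsilon> \<le> norm z" "norm z < \<rho>" by auto
          have "norm z powr (- d s) \<le> \<rho> powr (- d s) + \<epsilon> powr (- d s)"
          proof (cases "d s \<ge> 0")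
            case True
            then have "norm z powr (- d s) \<le> \<epsilon> powr (- d s)" using z \<epsilon> by (intro powr_mono2') auto
            then show ?thesis by (simp add: add_increasing)
          next
            case False
            then have "norm z powr (- d s) \<le> \<rho> powr (- d s)" using z \<epsilon> by (intro powr_mono2) auto
            then show ?thesis by (simp add: add_increasing2)
          qed
          moreover have "\<bar>b \<bullet> z\<bar> \<le> norm b * \<rho>"
            using Cauchy_Schwarz_ineq2[of b z] z by (meson less_imp_le mult_left_mono norm_ge_zero order_trans)
          ultimately have "\<bar>b \<bullet> z\<bar> * norm z powr (- d s) \<le> B"
            unfolding B_def using \<rho> by (intro mult_mono) auto
          then show ?thesis using True by (simp add: l_def abs_mult)
        qed (use B0 in \<open>auto simp: l_def\<close>)
        then show "AE z in lborel. norm (l z) \<le> norm (indicator (ball 0 \<rho>) z * B)"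
          using B0 by (intro AE_I2) (simp add: abs_mult)
      qed
    qed
    \<comment> \<open>The first order term is odd, so it disappears before the limit \<open>\<epsilon> \<rightarrow> 0\<close>.\<close>
    have l0: "(LINT z|lborel. l z) = 0"
    proof -
      have "l (- z) = - l z" for z by (simp add: l_def indicator_def)
      then show ?thesis using lborel_integral_reflect[OF l] by simp
    qed
    define j where "j z = indicator (ball 0 \<rho>) z * norm z powr (2 - d s)" for z :: "real^'n"
    define k where "k z = indicator (- ball 0 \<rho>) z * h z" for z
    have jk: "integrable lborel j" "integrable lborel k"
      using J h by (simp_all add: set_integrable_def j_def[abs_def] k_def[abs_def])
    have "(LINT z|lborel. g z) \<le> (LINT z|lborel. l z + (M * j z + k z))"
    proof (intro integral_mono g Bochner_Integration.integrable_add l jk integrable_mult_right)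
      fix z :: "real^'n"
      consider "norm z < \<epsilon>" | "\<epsilon> \<le> norm z" "norm z < \<rho>" | "\<rho> \<le> norm z" by linarith
      then show "g z \<le> l z + (M * j z + k z)"
      proof cases
        case 1
        then show ?thesis using \<epsilon> M by (simp add: g_eq l_def j_def k_def)
      next
        case 2
        have "\<sigma> * (u (x + z) - u x) * norm z powr (- d s) \<le> (b \<bullet> z + M * (norm z)\<^sup>2) * norm z powr (- d s)"
          using near[OF 2(2)] by (intro mult_right_mono) auto
        also have "\<dots> = (b \<bullet> z) * norm z powr (- d s) + M * norm z powr (2 - d s)"
        proof -
          have "(norm z)\<^sup>2 = norm z powr 2" using 2 \<epsilon> by simp
          then have "(norm z)\<^sup>2 * norm z powr (- d s) = norm z powr (2 - d s)"
            by (simp add: powr_add[symmetric] del: powr_numeral)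
          then show ?thesis by (simp add: distrib_right mult.assoc)
        qed
        finally show ?thesis using 2 by (simp add: g_eq l_def j_def k_def)
      next
        case 3
        then show ?thesis using far[OF 3] \<epsilon> by (simp add: g_eq l_def j_def k_def)
      qed
    qed
    also have "\<dots> = M * (LINT z|lborel. j z) + (LINT z|lborel. k z)"
      using l jk l0 by simp
    finally have "c * (- \<sigma> * F \<epsilon>) \<le> c * (M * (LINT z|lborel. j z) + (LINT z|lborel. k z))"
      using g c by (intro mult_left_mono) auto
    then show ?thesis
      by (simp add: set_lebesgue_integral_def j_def[abs_def] k_def[abs_def] mult_ac)
  qed
  show ?thesis
  proof (rule tendsto_upperbound[OF lim])
    show "\<forall>\<^sub>F \<epsilon> in at_right 0. - \<sigma> * (c * F \<epsilon>) \<le> ?R"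
      using eventually_at_right_real[OF \<rho>] by eventually_elim (use bound in auto)
  qed simp
qed

lemma powr_minus_tangent_le:
  fixes a q :: real
  assumes a: "0 < a" and q: "- (3/4) \<le> q"
  shows "1 - a * q \<le> (1 + q) powr (- a)"
    and "(1 + q) powr (- a) \<le> 1 - a * q + a * (a + 1) * 5 powr (a + 2) * q\<^sup>2"
proof -
  let ?A = "{- (4/5)<..} :: real set"
  have int: "0 \<in> interior ?A" by (simp add: interior_open)
  have D1: "((\<lambda>q. (1 + q) powr (- a)) has_real_derivative (- a) * (1 + q) powr (- a - 1)) (at q)"
    if "q \<in> ?A" for q
    using that by (auto intro!: derivative_eq_intros)
  have D2: "((\<lambda>q. (- a) * (1 + q) powr (- a - 1)) has_real_derivative
      a * (a + 1) * (1 + q) powr (- a - 2)) (at q)" if "q \<in> ?A" for q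
    using that by (auto intro!: derivative_eq_intros simp: algebra_simps)
  have "convex_on ?A (\<lambda>q. (1 + q) powr (- a))"
    by (rule f''_ge0_imp_convex[OF _ D1 D2]) (use a in auto)
  from convex_on_imp_above_tangent[OF this _ int, of q "- a"] D1[of 0] q
  show "1 - a * q \<le> (1 + q) powr (- a)"
    by (simp add: has_field_derivative_at_within)
  define C where "C = a * (a + 1) * 5 powr (a + 2)"
  define \<phi> where "\<phi> q = C * q\<^sup>2 - (1 + q) powr (- a)" for q
  have E1: "(\<phi> has_real_derivative 2 * C * q + a * (1 + q) powr (- a - 1)) (at q)"
    if "q \<in> ?A" for q
    unfolding \<phi>_def using that by (auto intro!: derivative_eq_intros)
  have E2: "((\<lambda>q. 2 * C * q + a * (1 + q) powr (- a - 1)) has_real_derivative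
      2 * C - a * (a + 1) * (1 + q) powr (- a - 2)) (at q)" if "q \<in> ?A" for q
    using that by (auto intro!: derivative_eq_intros simp: algebra_simps)
  have "convex_on ?A \<phi>"
  proof (rule f''_ge0_imp_convex[OF _ E1 E2])
    fix q assume q: "q \<in> ?A"
    have "(1 + q) powr (- a - 2) \<le> (1/5) powr (- a - 2)"
      using q a by (intro powr_mono2') auto
    also have "\<dots> = 5 powr (a + 2)"
      using powr_minus[of "1/5" "a + 2"] by (simp add: powr_divide)
    finally have "a * (a + 1) * (1 + q) powr (- a - 2) \<le> C"
      using a unfolding C_def by (intro mult_left_mono) auto
    moreover have "0 \<le> C" using a by (simp add: C_def)
    ultimately show "0 \<le> 2 * C - a * (a + 1) * (1 + q) powr (- a - 2)" by linarith
  qed auto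
  from convex_on_imp_above_tangent[OF this _ int, of q "a"] E1[of 0] q
  show "(1 + q) powr (- a) \<le> 1 - a * q + a * (a + 1) * 5 powr (a + 2) * q\<^sup>2"
    by (simp add: has_field_derivative_at_within \<phi>_def C_def)
qed

definition decay :: "real \<Rightarrow> 'a::real_inner \<Rightarrow> real" where
  "decay d x = (1 + (norm x)\<^sup>2) powr (- (d / 2))"

lemma decay_pos: "0 < decay d x"
  by (simp add: decay_def add_pos_nonneg powr_gt_zero add_nonneg_eq_0_iff)

lemma decay_le_1: "0 < d \<Longrightarrow> decay d x \<le> 1"
  using powr_mono2'[of "- (d / 2)" 1 "1 + (norm x)\<^sup>2"] by (simp add: decay_def)

lemma decay_le_norm_powr:
  assumes "0 < d" "x \<noteq> 0"
  shows "decay d x \<le> norm x powr (- d)"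
proof -
  have "decay d x \<le> ((norm x)\<^sup>2) powr (- (d / 2))"
    unfolding decay_def using assms by (intro powr_mono2') auto
  also have "\<dots> = norm x powr (- d)"
    using assms by (simp add: powr_powr flip: powr_numeral)
  finally show ?thesis .
qed

lemma decay_antimono:
  assumes "0 < d" "norm x \<le> r"
  shows "(1 + r\<^sup>2) powr (- (d / 2)) \<le> decay d x"
  unfolding decay_def using assms by (intro powr_mono2') (auto intro!: add_pos_nonneg power_mono)

lemma continuous_on_decay [continuous_intros]:
  "continuous_on A f \<Longrightarrow> continuous_on A (\<lambda>x. decay d (f x))"
  unfolding decay_def
  by (intro continuous_intros) (auto simp: add_nonneg_eq_0_iff)

lemma tendsto_decay:
  fixes f :: "'b \<Rightarrow> 'a::real_inner"
  assumes "0 < d" "filterlim (\<lambda>x. norm (f x)) at_top F"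
  shows "((\<lambda>x. decay d (f x)) \<longlongrightarrow> 0) F"
  unfolding decay_def using assms
  by (intro tendsto_neg_powr filterlim_tendsto_add_at_top[OF tendsto_const]
        filterlim_pow_at_top) auto

lemma decay_add_bounds:
  fixes x z :: "'a::real_inner"
  assumes d: "0 < d" and z: "norm z \<le> 1"
  defines "b \<equiv> (- (d / (1 + (norm x)\<^sup>2)) * decay d x) *\<^sub>R x"
  shows "decay d x + b \<bullet> z - d / 2 * decay d x * (norm z)\<^sup>2 \<le> decay d (x + z)"
    and "decay d (x + z) \<le> decay d x + b \<bullet> z
      + 2 * d * (d + 2) * 5 powr (d / 2 + 2) * decay d x * (norm z)\<^sup>2"
proof -
  define D where "D = 1 + (norm x)\<^sup>2"
  define q where "q = (2 * (x \<bullet> z) + (norm z)\<^sup>2) / D"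
  have D: "1 \<le> D" by (simp add: D_def)
  have "D * q = 2 * (x \<bullet> z) + (norm z)\<^sup>2"
    using D by (simp add: q_def)
  then have exp: "1 + (norm (x + z))\<^sup>2 = D * (1 + q)"
    by (simp add: D_def distrib_left power2_norm_eq_inner inner_add inner_commute)
  have "D \<le> 4 * (1 + (norm (x + z))\<^sup>2)"
  proof -
    have "norm x \<le> norm (x + z) + norm z" using norm_triangle_ineq4[of "x + z" z] by simp
    then have "(norm x)\<^sup>2 \<le> (norm (x + z) + 1)\<^sup>2" using z by (intro power_mono) auto
    also have "\<dots> \<le> 2 * (norm (x + z))\<^sup>2 + 2"
      using zero_le_power2[of "norm (x + z) - 1"] by (simp add: power2_eq_square algebra_simps)
    finally have le: "(norm x)\<^sup>2 \<le> 2 * (norm (x + z))\<^sup>2 + 2" .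
    define N where "N = (norm (x + z))\<^sup>2"
    have "0 \<le> N" by (simp add: N_def)
    then show ?thesis using le unfolding D_def N_def[symmetric] by argo
  qed
  then have "D * 1 \<le> D * (4 * (1 + q))" unfolding exp by (simp only: mult_ac mult_1_right)
  then have "1 \<le> 4 * (1 + q)" using D by (subst (asm) mult_le_cancel_left_pos) auto
  then have q: "- (3/4) \<le> q" by simp
  have w: "decay d (x + z) = decay d x * (1 + q) powr (- (d / 2))"
    unfolding decay_def exp D_def[symmetric] using D q by (simp add: powr_mult)
  have bz: "b \<bullet> z = decay d x * (- (d / D) * (x \<bullet> z))"
    by (simp add: b_def D_def)
  have aq: "- (d / 2) * q = - (d / D) * (x \<bullet> z) - d / 2 * ((norm z)\<^sup>2 / D)"
    using D by (simp add: q_def field_simps)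
  have zD: "0 \<le> (norm z)\<^sup>2 / D" "(norm z)\<^sup>2 / D \<le> (norm z)\<^sup>2"
    using D divide_left_mono[of 1 D "(norm z)\<^sup>2"] by auto
  have q2: "q\<^sup>2 \<le> 8 * (norm z)\<^sup>2"
  proof -
    have "\<bar>2 * (x \<bullet> z) + (norm z)\<^sup>2\<bar> \<le> 2 * (norm x * norm z) + norm z * norm z"
      using Cauchy_Schwarz_ineq2[of x z] abs_triangle_ineq[of "2 * (x \<bullet> z)" "(norm z)\<^sup>2"]
      by (simp add: power2_eq_square abs_mult)
    also have "\<dots> \<le> 2 * (norm x * norm z) + 1 * norm z"
      using z by (intro add_left_mono mult_right_mono) auto
    also have "\<dots> = (2 * norm x + 1) * norm z" by (simp add: algebra_simps)
    finally have "(2 * (x \<bullet> z) + (norm z)\<^sup>2)\<^sup>2 \<le> ((2 * norm x + 1) * norm z)\<^sup>2"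
      by (metis abs_ge_zero power2_abs power_mono)
    also have "\<dots> = (2 * norm x + 1)\<^sup>2 * (norm z)\<^sup>2" by (simp add: power_mult_distrib)
    also have "\<dots> \<le> (8 * D\<^sup>2) * (norm z)\<^sup>2"
    proof (intro mult_right_mono)
      have "(2 * norm x + 1)\<^sup>2 \<le> 8 * D"
        using zero_le_power2[of "2 * norm x - 1"] by (simp add: D_def power2_eq_square algebra_simps)
      also have "\<dots> \<le> 8 * D\<^sup>2" using D self_le_power[of D 2] by simp
      finally show "(2 * norm x + 1)\<^sup>2 \<le> 8 * D\<^sup>2" .
    qed auto
    finally show ?thesis unfolding q_def using D by (simp add: power_divide field_simps)
  qed
  have w0: "0 < decay d x" by (rule decay_pos)
  note T = powr_minus_tangent_le[OF half_gt_zero[OF d] q]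
  have "1 - (d / D) * (x \<bullet> z) - d / 2 * (norm z)\<^sup>2 \<le> (1 + q) powr (- (d / 2))"
  proof -
    have "d / 2 * ((norm z)\<^sup>2 / D) \<le> d / 2 * (norm z)\<^sup>2"
      using d zD by (intro mult_left_mono) auto
    then show ?thesis using T(1) d aq by linarith
  qed
  from mult_left_mono[OF this less_imp_le[OF w0]]
  show "decay d x + b \<bullet> z - d / 2 * decay d x * (norm z)\<^sup>2 \<le> decay d (x + z)"
    unfolding w bz by (simp add: algebra_simps)
  define K where "K = 2 * d * (d + 2) * 5 powr (d / 2 + 2)"
  have "d / 2 * (d / 2 + 1) * P * (8 * N) = 2 * d * (d + 2) * P * N" for P N :: real
    by (simp add: algebra_simps)
  then have eq: "d / 2 * (d / 2 + 1) * 5 powr (d / 2 + 2) * (8 * (norm z)\<^sup>2) = K * (norm z)\<^sup>2"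
    unfolding K_def .
  have "d / 2 * (d / 2 + 1) * 5 powr (d / 2 + 2) * q\<^sup>2
      \<le> d / 2 * (d / 2 + 1) * 5 powr (d / 2 + 2) * (8 * (norm z)\<^sup>2)"
    using d by (intro mult_left_mono[OF q2] mult_nonneg_nonneg) auto
  note order_trans[OF T(2) add_left_mono[OF this[unfolded eq]]]
  moreover have "0 \<le> d / 2 * ((norm z)\<^sup>2 / D)" using d zD(1) by (intro mult_nonneg_nonneg) auto
  ultimately have "(1 + q) powr (- (d / 2)) \<le> 1 - (d / D) * (x \<bullet> z) + K * (norm z)\<^sup>2"
    using aq by argo
  from mult_left_mono[OF this less_imp_le[OF w0]]
  show "decay d (x + z) \<le> decay d x + b \<bullet> z
      + 2 * d * (d + 2) * 5 powr (d / 2 + 2) * decay d x * (norm z)\<^sup>2"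
    unfolding w bz K_def[symmetric] by (simp add: algebra_simps)
qed

text \<open>One of \<open>x + z\<close> and \<open>z\<close> has norm comparable to that of \<open>x\<close> or larger, so one of the two factors is
  bounded by \<open>decay d x\<close>.\<close>

lemma decay_mult_norm_powr_le:
  fixes x z :: "'a::real_inner"
  assumes d: "0 < d" and z: "z \<noteq> 0"
  shows "decay d (x + z) * norm z powr (- d) \<le> 2 powr d * decay d x * (decay d (x + z) + norm z powr (- d))"
proof -
  define D where "D = 1 + (norm x)\<^sup>2"
  have D: "1 \<le> D" by (simp add: D_def)
  have scale: "(D / 4) powr (- (d / 2)) = 2 powr d * decay d x"
  proof -
    have "(4::real) powr (d / 2) = 2 powr d"
      using powr_powr[of "2::real" 2 "d / 2"] by simp
    then show ?thesis using D
      by (simp add: powr_divide powr_minus decay_def D_def[symmetric] divide_simps)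
  qed
  have nz: "norm z powr (- d) = ((norm z)\<^sup>2) powr (- (d / 2))"
    using z by (simp add: powr_powr flip: powr_numeral)
  have "norm x \<le> norm (x + z) + norm z" using norm_triangle_ineq4[of "x + z" z] by simp
  then have "(norm x)\<^sup>2 \<le> (norm (x + z) + norm z)\<^sup>2" by (intro power_mono) auto
  also have "\<dots> \<le> 2 * (norm (x + z))\<^sup>2 + 2 * (norm z)\<^sup>2"
    using zero_le_power2[of "norm (x + z) - norm z"] by (simp add: power2_eq_square algebra_simps)
  finally have "D / 4 \<le> 1 + (norm (x + z))\<^sup>2 \<or> D / 4 \<le> (norm z)\<^sup>2"
    by (simp add: D_def) linarith
  then have "decay d (x + z) \<le> 2 powr d * decay d x \<or> norm z powr (- d) \<le> 2 powr d * decay d x"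
  proof
    assume "D / 4 \<le> 1 + (norm (x + z))\<^sup>2"
    then have "decay d (x + z) \<le> (D / 4) powr (- (d / 2))"
      unfolding decay_def using D d by (intro powr_mono2') auto
    then show ?thesis by (simp add: scale)
  next
    assume "D / 4 \<le> (norm z)\<^sup>2"
    then have "norm z powr (- d) \<le> (D / 4) powr (- (d / 2))"
      unfolding nz using D d by (intro powr_mono2') auto
    then show ?thesis by (simp add: scale)
  qed
  then show ?thesis
  proof
    have w: "0 < decay d (x + z)" "0 < decay d x" by (rule decay_pos)+
    assume "decay d (x + z) \<le> 2 powr d * decay d x"
    then have "decay d (x + z) * norm z powr (- d) \<le> 2 powr d * decay d x * norm z powr (- d)"
      by (intro mult_right_mono) auto
    also have "\<dots> \<le> 2 powr d * decay d x * (decay d (x + z) + norm z powr (- d))"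
      using w by (intro mult_left_mono) auto
    finally show ?thesis .
  next
    have w: "0 < decay d (x + z)" "0 < decay d x" by (rule decay_pos)+
    assume "norm z powr (- d) \<le> 2 powr d * decay d x"
    then have "decay d (x + z) * norm z powr (- d) \<le> decay d (x + z) * (2 powr d * decay d x)"
      using w by (intro mult_left_mono) auto
    also have "\<dots> \<le> 2 powr d * decay d x * (decay d (x + z) + norm z powr (- d))"
      using w by (simp add: algebra_simps)
    finally show ?thesis .
  qed
qed

lemma scaled_decay_mult_norm_powr_le:
  fixes x z :: "'a::real_inner"
  assumes d: "0 < d" and \<delta>: "0 < \<delta>" and z: "z \<noteq> 0"
  shows "decay d (\<delta> *\<^sub>R (x + z)) * norm z powr (- d)
    \<le> 2 powr d * decay d (\<delta> *\<^sub>R x) * (\<delta> powr d * decay d (\<delta> *\<^sub>R (x + z)) + norm z powr (- d))"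
proof -
  have *: "norm (\<delta> *\<^sub>R z) powr (- d) = norm z powr (- d) / \<delta> powr d"
    using \<delta> by (simp add: powr_mult powr_minus divide_simps)
  have "decay d (\<delta> *\<^sub>R (x + z)) * (norm z powr (- d) / \<delta> powr d)
    \<le> 2 powr d * decay d (\<delta> *\<^sub>R x) * (decay d (\<delta> *\<^sub>R (x + z)) + norm z powr (- d) / \<delta> powr d)"
    using decay_mult_norm_powr_le[OF d, of "\<delta> *\<^sub>R z" "\<delta> *\<^sub>R x"] \<delta> z
    unfolding * by (simp add: scaleR_add_right)
  from mult_right_mono[OF this, of "\<delta> powr d"] show ?thesis
    using \<delta> by (simp add: algebra_simps)
qed

lemma attains_negative_inf:
  fixes v :: "'a::euclidean_space \<Rightarrow> real"
  assumes cont: "continuous_on UNIV v" and lim: "(v \<longlongrightarrow> 0) at_infinity" and neg: "v x1 < 0"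
  obtains x0 where "v x0 < 0" "\<And>y. v x0 \<le> v y"
proof -
  have "\<forall>\<^sub>F y in at_infinity. v x1 < v y"
    using lim neg by (rule order_tendstoD(1))
  then obtain r where r: "\<And>y. r \<le> norm y \<Longrightarrow> v x1 < v y"
    unfolding eventually_at_infinity by blast
  have x1: "x1 \<in> cball 0 r" using r[of x1] by force
  have "cball (0::'a) r \<noteq> {}" using x1 by blast
  then obtain x0 where "x0 \<in> cball 0 r" and x0: "\<And>y. y \<in> cball 0 r \<Longrightarrow> v x0 \<le> v y"
    using continuous_attains_inf[OF compact_cball _ continuous_on_subset[OF cont subset_UNIV]]
    by blast
  show thesis
  proof
    show "v x0 < 0" using x0[OF x1] neg by simp
    show "v x0 \<le> v y" for y
    proof (cases "y \<in> cball 0 r")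
      case False
      then show ?thesis using r[of y] x0[OF x1] by force
    qed (rule x0)
  qed
qed

lemma C_k_2_continuous: "C_k 2 u \<Longrightarrow> continuous_on UNIV u"
  by (auto simp: numeral_2_eq_2 intro: differentiable_imp_continuous_on)

lemma solution_upper_bound:
  fixes u :: "real^'n \<Rightarrow> real"
  defines "d \<equiv> \<lambda>s. real CARD('n) + 2 * s"
  assumes s: "0 < s" "s < 1" and c: "0 \<le> c" and p: "1 < p"
    and sol: "positive_classical_solution c s p u" and lim: "(u \<longlongrightarrow> 0) at_infinity"
  obtains C where "0 < C" "\<And>x. x \<noteq> 0 \<Longrightarrow> u x \<le> C * norm x powr (- d s)"
proof -
  have d0: "0 < d s" using s by (simp add: d_def)
  have u2: "C_k 2 u" and upos: "\<And>x. 0 < u x"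
    using sol by (auto simp: positive_classical_solution_def)
  have cont: "continuous_on UNIV u" by (rule C_k_2_continuous[OF u2])
  obtain R where R: "0 < R" "\<And>x. R \<le> norm x \<Longrightarrow> u x powr p \<le> u x / 2"
  proof -
    define m where "m = (1/2::real) powr (1 / (p - 1))"
    have "0 < m" by (simp add: m_def)
    have "\<forall>\<^sub>F x in at_infinity. u x < m" using lim \<open>0 < m\<close> by (rule order_tendstoD(2))
    then obtain R where R: "0 < R" "\<And>x. R \<le> norm x \<Longrightarrow> u x < m"
      unfolding eventually_at_infinity_pos by blast
    have "u x powr p \<le> u x / 2" if "R \<le> norm x" for x
    proof -
      have "u x powr p = u x * u x powr (p - 1)"
        using upos[of x] by (simp add: powr_diff)
      also have "\<dots> \<le> u x * m powr (p - 1)"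
        using upos[of x] R(2)[OF that] p by (intro mult_left_mono powr_mono2) auto
      also have "m powr (p - 1) = 1/2" using p by (simp add: m_def powr_powr)
      finally show ?thesis by simp
    qed
    with R(1) show thesis by (rule that)
  qed
  define \<tau> where "\<tau> r = (LINT z:(- ball (0::real^'n) r)|lborel. norm z powr (- d s))" for r
  have tail: "set_integrable lborel (- ball (0::real^'n) r) (\<lambda>z. norm z powr (- d s))" if "0 < r" for r
    using that s by (intro set_integrable_norm_powr_outside_ball) (auto simp: d_def)
  obtain \<rho> where \<rho>: "0 < \<rho>" "c * (2 powr d s * (2 * \<tau> \<rho>)) < 1/2"
  proof -
    have "(\<lambda>k. c * (2 powr d s * (2 * \<tau> (real (Suc k))))) \<longlonglongrightarrow> c * (2 powr d s * (2 * 0))"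
      unfolding \<tau>_def by (intro tendsto_intros tendsto_set_integral_outside_ball tail) simp
    then have "\<forall>\<^sub>F k in sequentially. c * (2 powr d s * (2 * \<tau> (real (Suc k)))) < 1/2"
      by (rule order_tendstoD(2)) simp
    then obtain k where "c * (2 powr d s * (2 * \<tau> (real (Suc k)))) < 1/2"
      by (meson eventually_sequentially order_refl)
    then show thesis by (intro that[of "real (Suc k)"]) auto
  qed
  define K where "K = 2 * d s * (d s + 2) * 5 powr (d s / 2 + 2)"
  define J where "J = (LINT z:ball (0::real^'n) \<rho>|lborel. norm z powr (2 - d s))"
  define V where "V = measure lborel (ball (0::real^'n) \<rho>)"
  define P where "P \<delta> = 2 * real CARD('n) * (K * \<delta>\<^sup>2)
      + c * (K * \<delta>\<^sup>2 * J + 2 powr d s * (\<delta> powr d s * V + 2 * \<tau> \<rho>))" for \<delta>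
  have K0: "0 \<le> K" using d0 by (simp add: K_def)
  obtain \<delta> where \<delta>: "0 < \<delta>" "\<delta> * \<rho> < 1" "P \<delta> < 1/2"
  proof -
    have "((\<lambda>\<delta>. \<delta> powr d s) \<longlongrightarrow> 0 powr d s) (at_right 0)"
      using d0 by (intro tendsto_powr' tendsto_intros) (auto intro: eventually_at_right_less[THEN eventually_mono])
    then have pw: "((\<lambda>\<delta>. \<delta> powr d s) \<longlongrightarrow> 0) (at_right 0)" using d0 by simp
    have "(P \<longlongrightarrow> 2 * real CARD('n) * (K * 0\<^sup>2)
      + c * (K * 0\<^sup>2 * J + 2 powr d s * (0 * V + 2 * \<tau> \<rho>))) (at_right 0)"
      unfolding P_def by (intro tendsto_intros pw)
    then have "\<forall>\<^sub>F \<delta> in at_right 0. P \<delta> < 1/2"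
      by (rule order_tendstoD(2)) (use \<rho>(2) in simp)
    moreover have "\<forall>\<^sub>F \<delta> in at_right 0. \<delta> \<in> {0<..<1 / \<rho>}"
      using \<rho>(1) by (intro eventually_at_right_real) simp
    ultimately have "\<forall>\<^sub>F \<delta> in at_right 0. 0 < \<delta> \<and> \<delta> * \<rho> < 1 \<and> P \<delta> < 1/2"
      by eventually_elim (use \<rho>(1) in \<open>auto simp: field_simps\<close>)
    then show thesis
      using that eventually_happens trivial_limit_at_right_real by (metis (mono_tags, lifting))
  qed
  obtain B where B: "0 < B" "\<And>x. norm x \<le> R \<Longrightarrow> u x \<le> B"
  proof -
    have "cball (0::real^'n) R \<noteq> {}" using R(1) by simp
    then obtain y where "\<And>x. x \<in> cball 0 R \<Longrightarrow> u x \<le> u y"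
      using continuous_attains_sup[OF compact_cball _ continuous_on_subset[OF cont subset_UNIV]]
      by blast
    then show thesis by (intro that[of "u y"] upos) auto
  qed
  define A where "A = B * (1 + (\<delta> * R)\<^sup>2) powr (d s / 2)"
  have A: "0 < A" using B(1) by (simp add: A_def add_pos_nonneg powr_gt_zero add_nonneg_eq_0_iff)
  have inside: "u x \<le> A * decay (d s) (\<delta> *\<^sub>R x)" if "norm x \<le> R" for x
  proof -
    have "B = A * (1 + (\<delta> * R)\<^sup>2) powr (- (d s / 2))"
    proof -
      have "(1 + (\<delta> * R)\<^sup>2) powr (d s / 2) * (1 + (\<delta> * R)\<^sup>2) powr (- (d s / 2)) = 1"
        by (simp add: powr_add[symmetric] add_nonneg_eq_0_iff)
      then show ?thesis unfolding A_def by (simp only: mult.assoc mult_1_right)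
    qed
    also have "\<dots> \<le> A * decay (d s) (\<delta> *\<^sub>R x)"
      using A \<delta> that by (intro mult_left_mono decay_antimono d0) (auto intro: mult_left_mono)
    finally show ?thesis using B(2)[OF that] by simp
  qed
  have main: "u x \<le> A * decay (d s) (\<delta> *\<^sub>R x)" for x
  proof (rule ccontr)
    assume contra: "\<not> u x \<le> A * decay (d s) (\<delta> *\<^sub>R x)"
    define v where "v x = A * decay (d s) (\<delta> *\<^sub>R x) - u x" for x
    have "((\<lambda>x. decay (d s) (\<delta> *\<^sub>R x)) \<longlongrightarrow> 0) (at_infinity :: (real^'n) filter)"
      using \<delta>(1) by (intro tendsto_decay d0)
        (auto intro!: filterlim_tendsto_pos_mult_at_top[OF tendsto_const] filterlim_norm_at_top)
    then have "(v \<longlongrightarrow> A * 0 - 0) at_infinity"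
      unfolding v_def by (intro tendsto_intros lim)
    then have "(v \<longlongrightarrow> 0) at_infinity" by simp
    moreover have "continuous_on UNIV v"
      unfolding v_def by (intro continuous_intros cont)
    moreover have "v x < 0" using contra by (simp add: v_def)
    ultimately obtain x0 where x0: "v x0 < 0" "\<And>y. v x0 \<le> v y"
      using attains_negative_inf by blast
    define W where "W = A * decay (d s) (\<delta> *\<^sub>R x0)"
    have W: "0 < W" "W < u x0" using x0(1) mult_pos_pos[OF A decay_pos] by (auto simp: W_def v_def)
    have touch: "u (x0 + z) - u x0 \<le> A * decay (d s) (\<delta> *\<^sub>R (x0 + z)) - W" for z
      using x0(2)[of "x0 + z"] by (simp add: v_def W_def)
    have far_x0: "R \<le> norm x0" using inside[of x0] x0(1) by (force simp: v_def)
    obtain L where L: "has_fractional_laplacian c s u x0 L"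
        "- laplacian u x0 + L + u x0 = u x0 powr p"
      using sol unfolding positive_classical_solution_def by blast
    define b where "b = (- (d s / (1 + (norm (\<delta> *\<^sub>R x0))\<^sup>2)) * decay (d s) (\<delta> *\<^sub>R x0)) *\<^sub>R (\<delta> *\<^sub>R x0)"
    have near: "1 * (u (x0 + z) - u x0) \<le> ((A * \<delta>) *\<^sub>R b) \<bullet> z + K * \<delta>\<^sup>2 * W * (norm z)\<^sup>2"
      if "norm z < \<rho>" for z
    proof -
      have "\<delta> * norm z \<le> \<delta> * \<rho>" using that \<delta>(1) by (intro mult_left_mono) auto
      with \<delta>(2) have "\<delta> * norm z \<le> 1" by linarith
      then have "norm (\<delta> *\<^sub>R z) \<le> 1" using \<delta>(1) by simp
      from decay_add_bounds(2)[OF d0 this, of "\<delta> *\<^sub>R x0"]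
      have "decay (d s) (\<delta> *\<^sub>R (x0 + z)) \<le> decay (d s) (\<delta> *\<^sub>R x0) + \<delta> * (b \<bullet> z)
          + K * decay (d s) (\<delta> *\<^sub>R x0) * (\<delta>\<^sup>2 * (norm z)\<^sup>2)"
        unfolding b_def[symmetric] K_def[symmetric] scaleR_add_right
        using \<delta>(1) by (simp add: power_mult_distrib)
      from mult_left_mono[OF this less_imp_le[OF A]]
      have "A * decay (d s) (\<delta> *\<^sub>R (x0 + z)) \<le> W + (A * \<delta>) * (b \<bullet> z) + K * \<delta>\<^sup>2 * W * (norm z)\<^sup>2"
        by (simp add: W_def algebra_simps)
      then show ?thesis using touch[of z] by simp
    qed
    \<comment> \<open>A majorant of \<open>\<delta> powr d s * decay (d s) (\<delta> *\<^sub>R y)\<close> whose integral is small for large \<open>\<rho>\<close> and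
      then small \<open>\<delta>\<close>, which avoids changing variables by the dilation.\<close>
    define G where "G y = indicator (ball 0 \<rho>) y * \<delta> powr d s
        + indicator (- ball 0 \<rho>) y * norm y powr (- d s)" for y :: "real^'n"
    have G: "integrable lborel G" "(LINT y|lborel. G y) = V * \<delta> powr d s + \<tau> \<rho>"
    proof -
      have 1: "integrable lborel (\<lambda>y. indicator (ball 0 \<rho>) (y::real^'n) * \<delta> powr d s)"
        using emeasure_lborel_ball_finite[of "0::real^'n" \<rho>]
        by (intro integrable_mult_left integrable_real_indicator) auto
      have 2: "integrable lborel (\<lambda>y. indicator (- ball 0 \<rho>) y * norm (y::real^'n) powr (- d s))"
        using tail[OF \<rho>(1)] by (simp add: set_integrable_def)
      show "integrable lborel G" "(LINT y|lborel. G y) = V * \<delta> powr d s + \<tau> \<rho>"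
        unfolding G_def[abs_def] using 1 2
        by (simp_all add: V_def \<tau>_def set_lebesgue_integral_def)
    qed
    have G_ge: "\<delta> powr d s * decay (d s) (\<delta> *\<^sub>R y) \<le> G y" for y
    proof (cases "y \<in> ball 0 \<rho>")
      case True
      then show ?thesis
        using decay_le_1[OF d0, of "\<delta> *\<^sub>R y"] by (simp add: G_def mult_left_le)
    next
      case False
      then have "y \<noteq> 0" using \<rho>(1) by auto
      then have "decay (d s) (\<delta> *\<^sub>R y) \<le> norm y powr (- d s) / \<delta> powr d s"
        using decay_le_norm_powr[OF d0, of "\<delta> *\<^sub>R y"] \<delta>(1)
        by (simp add: powr_mult powr_minus divide_simps mult.commute)
      then show ?thesis using False \<delta>(1) by (simp add: G_def field_simps)
    qed
    have G0: "0 \<le> G y" for y by (simp add: G_def)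
    define h where "h z = 2 powr d s * W * (G (x0 + z) + norm z powr (- d s))" for z
    have far: "1 * (u (x0 + z) - u x0) * norm z powr (- d s) \<le> h z" if "\<rho> \<le> norm z" for z
    proof -
      have "z \<noteq> 0" using that \<rho>(1) by auto
      have "1 * (u (x0 + z) - u x0) * norm z powr (- d s)
          \<le> A * decay (d s) (\<delta> *\<^sub>R (x0 + z)) * norm z powr (- d s)"
        using touch[of z] W(1) by (intro mult_right_mono) auto
      also have "\<dots> = A * (decay (d s) (\<delta> *\<^sub>R (x0 + z)) * norm z powr (- d s))" by simp
      also have "\<dots> \<le> A * (2 powr d s * decay (d s) (\<delta> *\<^sub>R x0) *
          (\<delta> powr d s * decay (d s) (\<delta> *\<^sub>R (x0 + z)) + norm z powr (- d s)))"
        using A by (intro mult_left_mono scaled_decay_mult_norm_powr_le d0 \<delta>(1) \<open>z \<noteq> 0\<close>) auto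
      also have "\<dots> = 2 powr d s * W *
          (\<delta> powr d s * decay (d s) (\<delta> *\<^sub>R (x0 + z)) + norm z powr (- d s))"
        by (simp add: W_def)
      also have "\<dots> \<le> h z"
        unfolding h_def using W(1) by (intro mult_left_mono add_right_mono G_ge) auto
      finally show ?thesis .
    qed
    have shift: "integrable lborel (\<lambda>z. G (x0 + z))" "(LINT z|lborel. G (x0 + z)) = V * \<delta> powr d s + \<tau> \<rho>"
      using lborel_integral_translate[OF G(1), of x0] G(2) by auto
    have Gset: "set_integrable lborel (- ball 0 \<rho>) (\<lambda>z. G (x0 + z))"
      unfolding set_integrable_def using shift(1)
      by (intro integrable_mult_indicator) auto
    have h: "set_integrable lborel (- ball 0 \<rho>) h"
      unfolding h_def using Gset tail[OF \<rho>(1)]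
      by (intro set_integrable_mult_right set_integral_add) auto
    have "(LINT z:(- ball 0 \<rho>)|lborel. h z)
        = 2 powr d s * W * ((LINT z:(- ball 0 \<rho>)|lborel. G (x0 + z)) + \<tau> \<rho>)"
      unfolding h_def \<tau>_def using Gset tail[OF \<rho>(1)]
      by (subst set_integral_mult_right, subst set_integral_add) auto
    also have "\<dots> \<le> 2 powr d s * W * ((V * \<delta> powr d s + \<tau> \<rho>) + \<tau> \<rho>)"
    proof (intro mult_left_mono add_right_mono)
      have "(LINT z:(- ball 0 \<rho>)|lborel. G (x0 + z)) \<le> (LINT z|lborel. G (x0 + z))"
        unfolding set_lebesgue_integral_def
        using Gset[unfolded set_integrable_def] shift(1)
        by (rule integral_mono) (use G0 in \<open>auto simp: indicator_def\<close>)
      then show "(LINT z:(- ball 0 \<rho>)|lborel. G (x0 + z)) \<le> V * \<delta> powr d s + \<tau> \<rho>"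
        by (simp add: shift)
    qed (use W(1) in auto)
    finally have hint: "(LINT z:(- ball 0 \<rho>)|lborel. h z) \<le> 2 powr d s * W * (V * \<delta> powr d s + 2 * \<tau> \<rho>)"
      by (simp only: add.assoc mult_2)
    have M: "0 \<le> K * \<delta>\<^sup>2 * W" using K0 W(1) by simp
    have "- 1 * L \<le> c * (K * \<delta>\<^sup>2 * W * J + (LINT z:(- ball 0 \<rho>)|lborel. h z))"
      unfolding J_def d_def
      by (rule fractional_laplacian_ge[OF L(1) s(2) c \<rho>(1) M near far[unfolded d_def] h])
    also have "\<dots> \<le> c * (K * \<delta>\<^sup>2 * W * J + 2 powr d s * W * (V * \<delta> powr d s + 2 * \<tau> \<rho>))"
      using hint c by (intro mult_left_mono add_left_mono) auto
    finally have "laplacian u x0 - L \<le> W * P \<delta>"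
      using laplacian_le[OF u2 \<rho>(1) near] by (simp add: P_def algebra_simps)
    also have "\<dots> \<le> W * (1/2)" using W(1) \<delta>(3) by (intro mult_left_mono) auto
    also have "\<dots> < u x0 / 2" using W(2) by simp
    finally show False using L(2) R(2)[OF far_x0] by simp
  qed
  show thesis
  proof
    show "0 < A * \<delta> powr (- d s)" using A \<delta> by simp
    fix x :: "real^'n" assume "x \<noteq> 0"
    have "u x \<le> A * decay (d s) (\<delta> *\<^sub>R x)" by (rule main)
    also have "\<dots> \<le> A * norm (\<delta> *\<^sub>R x) powr (- d s)"
      using A \<delta> \<open>x \<noteq> 0\<close> by (intro mult_left_mono decay_le_norm_powr d0) auto
    also have "\<dots> = A * \<delta> powr (- d s) * norm x powr (- d s)"
      using \<delta> by (simp add: powr_mult)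
    finally show "u x \<le> A * \<delta> powr (- d s) * norm x powr (- d s)" .
  qed
qed

lemma solution_lower_bound:
  fixes u :: "real^'n \<Rightarrow> real"
  defines "d \<equiv> \<lambda>s. real CARD('n) + 2 * s"
  assumes s: "0 < s" "s < 1" and c: "0 < c"
    and sol: "positive_classical_solution c s p u" and lim: "(u \<longlongrightarrow> 0) at_infinity"
  obtains \<eta> where "0 < \<eta>" "\<And>x. \<eta> * decay (d s) x \<le> u x"
proof -
  have d0: "0 < d s" using s by (simp add: d_def)
  have u2: "C_k 2 u" and upos: "\<And>x. 0 < u x"
    using sol by (auto simp: positive_classical_solution_def)
  have cont: "continuous_on UNIV u" by (rule C_k_2_continuous[OF u2])
  obtain m where m: "0 < m" "\<And>x. norm x \<le> 2 \<Longrightarrow> m \<le> u x"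
  proof -
    have "cball (0::real^'n) 2 \<noteq> {}" by simp
    then obtain y where "\<And>x. x \<in> cball 0 2 \<Longrightarrow> u y \<le> u x"
      using continuous_attains_inf[OF compact_cball _ continuous_on_subset[OF cont subset_UNIV]]
      by blast
    then show thesis by (intro that[of "u y"] upos) auto
  qed
  define \<tau> where "\<tau> = (LINT z:(- ball (0::real^'n) 1)|lborel. norm z powr (- d s))"
  have tail: "set_integrable lborel (- ball (0::real^'n) 1) (\<lambda>z. norm z powr (- d s))"
    using s by (intro set_integrable_norm_powr_outside_ball) (auto simp: d_def)
  define J where "J = (LINT z:ball (0::real^'n) 1|lborel. norm z powr (2 - d s))"
  define V where "V = measure lborel (ball (0::real^'n) 1)"
  define Q where "Q = 2 * real CARD('n) * (d s / 2) + c * (d s / 2 * J + \<tau>) + 1"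
  define \<kappa> where "\<kappa> = c * (m * 2 powr (- d s) * V)"
  have V: "0 < V" unfolding V_def by (simp add: content_ball_pos)
  have J0: "0 \<le> J" and \<tau>0: "0 \<le> \<tau>"
    unfolding J_def \<tau>_def set_lebesgue_integral_def by (auto intro!: integral_nonneg_AE)
  have Q: "0 < Q" using d0 c J0 \<tau>0 unfolding Q_def
    by (intro add_nonneg_pos add_nonneg_nonneg mult_nonneg_nonneg) auto
  have \<kappa>: "0 < \<kappa>" using c m(1) V by (simp add: \<kappa>_def)
  define \<eta> where "\<eta> = min m (\<kappa> / Q)"
  have \<eta>: "0 < \<eta>" "\<eta> \<le> m" "\<eta> * Q \<le> \<kappa>"
    using m(1) \<kappa> Q by (auto simp: \<eta>_def min_def field_simps)
  have inside: "\<eta> * decay (d s) x \<le> u x" if "norm x \<le> 2" for x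
  proof -
    have "\<eta> * decay (d s) x \<le> m * 1"
      using \<eta> m(1) decay_le_1[OF d0] decay_pos[of "d s" x] by (intro mult_mono) auto
    then show ?thesis using m(2)[OF that] by simp
  qed
  have main: "\<eta> * decay (d s) x \<le> u x" for x
  proof (rule ccontr)
    assume contra: "\<not> \<eta> * decay (d s) x \<le> u x"
    define v where "v x = u x - \<eta> * decay (d s) x" for x
    have "((\<lambda>x. decay (d s) x) \<longlongrightarrow> 0) (at_infinity :: (real^'n) filter)"
      by (intro tendsto_decay d0 filterlim_norm_at_top)
    then have "(v \<longlongrightarrow> 0 - \<eta> * 0) at_infinity"
      unfolding v_def by (intro tendsto_intros lim)
    then have "(v \<longlongrightarrow> 0) at_infinity" by simp
    moreover have "continuous_on UNIV v"
      unfolding v_def by (intro continuous_intros cont)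
    moreover have "v x < 0" using contra by (simp add: v_def)
    ultimately obtain x0 where x0: "v x0 < 0" "\<And>y. v x0 \<le> v y"
      using attains_negative_inf by blast
    define W where "W = \<eta> * decay (d s) x0"
    have W: "0 < W" "u x0 < W" using x0(1) mult_pos_pos[OF \<eta>(1) decay_pos] by (auto simp: W_def v_def)
    have touch: "u x0 - u (x0 + z) \<le> W - \<eta> * decay (d s) (x0 + z)" for z
      using x0(2)[of "x0 + z"] by (simp add: v_def W_def)
    have far_x0: "2 < norm x0" using inside[of x0] x0(1) by (force simp: v_def)
    obtain L where L: "has_fractional_laplacian c s u x0 L"
        "- laplacian u x0 + L + u x0 = u x0 powr p"
      using sol unfolding positive_classical_solution_def by blast
    define b where "b = (- (d s / (1 + (norm x0)\<^sup>2)) * decay (d s) x0) *\<^sub>R x0"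
    have near: "(- 1) * (u (x0 + z) - u x0) \<le> ((- \<eta>) *\<^sub>R b) \<bullet> z + d s / 2 * W * (norm z)\<^sup>2"
      if "norm z < 1" for z
    proof -
      have "decay (d s) x0 + b \<bullet> z - d s / 2 * decay (d s) x0 * (norm z)\<^sup>2 \<le> decay (d s) (x0 + z)"
        using decay_add_bounds(1)[OF d0 less_imp_le[OF that], of x0] unfolding b_def .
      from mult_left_mono[OF this less_imp_le[OF \<eta>(1)]]
      have "W + \<eta> * (b \<bullet> z) - d s / 2 * W * (norm z)\<^sup>2 \<le> \<eta> * decay (d s) (x0 + z)"
        by (simp add: W_def algebra_simps)
      then show ?thesis using touch[of z] by simp
    qed
    define N where "N = m * (2 powr (- d s) * norm x0 powr (- d s))"
    define h where "h z = W * norm z powr (- d s) - N * indicator (ball (- x0) 1) z" for z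
    have far: "(- 1) * (u (x0 + z) - u x0) * norm z powr (- d s) \<le> h z" if z: "1 \<le> norm z" for z
    proof -
      have "(- 1) * (u (x0 + z) - u x0) * norm z powr (- d s)
          = u x0 * norm z powr (- d s) - u (x0 + z) * norm z powr (- d s)"
        by (simp add: algebra_simps)
      also have "\<dots> \<le> W * norm z powr (- d s) - N * indicator (ball (- x0) 1) z"
      proof (intro diff_mono)
        show "u x0 * norm z powr (- d s) \<le> W * norm z powr (- d s)"
          using W by (intro mult_right_mono) auto
        show "N * indicator (ball (- x0) 1) z \<le> u (x0 + z) * norm z powr (- d s)"
        proof (cases "z \<in> ball (- x0) 1")
          case True
          have "- x0 - z = - (x0 + z)" by simp
          with True have n1: "norm (x0 + z) < 1"
            unfolding mem_ball dist_norm by (metis norm_minus_cancel)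
          have "norm z \<le> norm (x0 + z) + norm x0"
            using norm_triangle_ineq4[of "x0 + z" x0] by simp
          then have "norm z \<le> 2 * norm x0" using n1 far_x0 by linarith
          then have "(2 * norm x0) powr (- d s) \<le> norm z powr (- d s)"
            using z d0 by (intro powr_mono2') auto
          then have "m * (2 powr (- d s) * norm x0 powr (- d s)) \<le> u (x0 + z) * norm z powr (- d s)"
            using m n1 upos[of "x0 + z"] by (intro mult_mono) (auto simp: powr_mult)
          then show ?thesis using True by (simp add: N_def)
        qed (use upos[of "x0 + z"] in simp)
      qed
      finally show ?thesis by (simp add: h_def)
    qed
    have sub: "ball (- x0) 1 \<subseteq> - ball 0 1"
    proof
      fix z assume "z \<in> ball (- x0) 1"
      then have "norm (x0 + z) < 1"
        unfolding mem_ball dist_norm by (metis minus_add_distrib norm_minus_cancel diff_conv_add_uminus)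
      moreover have "norm x0 \<le> norm (x0 + z) + norm z"
        using norm_triangle_ineq4[of "x0 + z" z] by simp
      ultimately show "z \<in> - ball 0 1" using far_x0 by simp
    qed
    have Bset: "set_integrable lborel (- ball (0::real^'n) 1) (indicator (ball (- x0) 1) :: _ \<Rightarrow> real)"
      and Bint: "(LINT z:(- ball (0::real^'n) 1)|lborel. (indicator (ball (- x0) 1) z :: real)) = V"
    proof -
      have eq: "(\<lambda>z. indicat_real (- ball (0::real^'n) 1) z *\<^sub>R indicat_real (ball (- x0) 1) z)
          = indicator (ball (- x0) 1)"
        using sub by (auto simp: indicator_def fun_eq_iff)
      have "measure lborel (ball (- x0) 1) = V"
        by (simp add: V_def content_ball)
      then show "set_integrable lborel (- ball (0::real^'n) 1) (indicator (ball (- x0) 1) :: _ \<Rightarrow> real)"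
        "(LINT z:(- ball (0::real^'n) 1)|lborel. (indicator (ball (- x0) 1) z :: real)) = V"
        unfolding set_integrable_def set_lebesgue_integral_def eq
        using emeasure_lborel_ball_finite[of "- x0" 1]
        by (auto intro!: integrable_real_indicator)
    qed
    have h: "set_integrable lborel (- ball 0 1) h"
      unfolding h_def using Bset tail by (intro set_integral_diff set_integrable_mult_right) auto
    have hint: "(LINT z:(- ball 0 1)|lborel. h z) = W * \<tau> - N * V"
      unfolding h_def \<tau>_def using Bset Bint tail
      by (subst set_integral_diff) auto
    have M: "0 \<le> d s / 2 * W" using d0 W(1) by simp
    have "- (- 1) * L \<le> c * (d s / 2 * W * J + (W * \<tau> - N * V))"
      unfolding hint[symmetric] J_def d_def
      by (rule fractional_laplacian_ge[OF L(1) s(2) less_imp_le[OF c] zero_less_one M[unfolded d_def]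
            near[unfolded d_def] far[unfolded d_def] h])
    moreover have "(- 1) * laplacian u x0 \<le> 2 * real CARD('n) * (d s / 2 * W)"
      by (rule laplacian_le[OF u2 zero_less_one near])
    ultimately have "u x0 powr p < 2 * real CARD('n) * (d s / 2 * W)
        + c * (d s / 2 * W * J + (W * \<tau> - N * V)) + W"
      using L(2) W(2) by linarith
    also have "\<dots> = W * Q - norm x0 powr (- d s) * \<kappa>"
      by (simp add: Q_def \<kappa>_def N_def algebra_simps)
    also have "\<dots> \<le> 0"
    proof -
      have "W * Q \<le> (\<eta> * norm x0 powr (- d s)) * Q"
        unfolding W_def using \<eta>(1) Q far_x0
        by (intro mult_right_mono mult_left_mono decay_le_norm_powr d0) auto
      also have "\<dots> = norm x0 powr (- d s) * (\<eta> * Q)" by simp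
      also have "\<dots> \<le> norm x0 powr (- d s) * \<kappa>"
        using \<eta>(3) by (intro mult_left_mono) auto
      finally show ?thesis by simp
    qed
    finally show False by (simp add: not_less powr_ge_zero)
  qed
  show thesis by (rule that[OF \<eta>(1) main])
qed

theorem theorem4p2:
  fixes u :: "real^'n \<Rightarrow> real" and s p c :: real
  assumes "CARD('n) \<ge> 2"
    and "0 < s" and "s < 1"
    and "c > 0"
    and "1 < p"
    and "CARD('n) > 2 \<Longrightarrow> p < (real CARD('n) + 2) / (real CARD('n) - 2)"
    and "positive_classical_solution c s p u"
    and "(u \<longlongrightarrow> 0) at_infinity"
  shows "\<exists>C1 C2. 0 < C1 \<and> C1 \<le> C2 \<and>
    (\<forall>x. norm x \<ge> 1 \<longrightarrow>
       C1 / norm x powr (real CARD('n) + 2 * s) \<le> u x \<and>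
       u x \<le> C2 / norm x powr (real CARD('n) + 2 * s))"
proof -
  define d where "d = real CARD('n) + 2 * s"
  have d0: "0 < d" using assms(2) by (simp add: d_def)
  obtain C where C: "0 < C" "\<And>x. x \<noteq> 0 \<Longrightarrow> u x \<le> C * norm x powr (- d)"
    using solution_upper_bound[of s c p u] assms unfolding d_def by auto
  obtain \<eta> where \<eta>: "0 < \<eta>" "\<And>x. \<eta> * decay d x \<le> u x"
    using solution_lower_bound[of s c p u] assms unfolding d_def by auto
  define C1 where "C1 = \<eta> * 2 powr (- (d / 2))"
  have "C1 / norm x powr d \<le> u x \<and> u x \<le> max C1 C / norm x powr d" if x: "1 \<le> norm x" for x
  proof
    have eq: "norm x powr (- d) = ((norm x)\<^sup>2) powr (- (d / 2))"
      using x by (simp add: powr_powr flip: powr_numeral)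
    have "C1 / norm x powr d = \<eta> * (2 powr (- (d / 2)) * norm x powr (- d))"
      by (simp add: C1_def powr_minus_divide[of "norm x"])
    also have "\<dots> = \<eta> * (2 * (norm x)\<^sup>2) powr (- (d / 2))"
      unfolding eq by (subst powr_mult) auto
    also have "\<dots> \<le> \<eta> * decay d x"
      unfolding decay_def using \<eta>(1) d0 x
      by (intro mult_left_mono powr_mono2') (auto simp: one_le_power intro: add_pos_nonneg)
    finally show "C1 / norm x powr d \<le> u x" using \<eta>(2)[of x] by simp
    have "u x \<le> C * norm x powr (- d)" using x by (intro C(2)) auto
    also have "\<dots> \<le> max C1 C / norm x powr d"
      by (simp add: powr_minus_divide divide_right_mono)
    finally show "u x \<le> max C1 C / norm x powr d" .
  qed
  moreover have "0 < C1" using \<eta>(1) by (simp add: C1_def)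
  ultimately show ?thesis
    unfolding d_def by (intro exI[of _ C1] exI[of _ "max C1 C"]) auto
qed

end
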